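(* Let $\mu$ be a tight-frame spectral measure on $\mathbb{R}^d$ with a tight-frame spectrum $\Lambda$, and let $U\subseteq\mathbb{R}^d$ be an open set such that $\mu*\widetilde\mu$ is absolutely continuous in $U$ with a smooth, strictly positive density therein. Then $$\operatorname{supp}\widehat{\delta_\Lambda}\cap U\subseteq\{0\}.$$
   Context: A measure always means a compactly supported Borel probability measure on $\mathbb{R}^d$. $\mu$ is a tight-frame spectral measure with tight-frame spectrum $\Lambda$ (a countable subset of $\mathbb{R}^d$) if there is a constant $A>0$ with $\sum_{\lambda\in\Lambda}\left|\int f(x)e^{-2\pi i\lambda\cdot x}\,d\mu(x)\right|^2=A\int |f|^2\,d\mu$ for all $f\in L^2(\mu)$. $\widetilde\mu(E)=\mu(-E)$, and $\mu*\nu(E)=\iint \mathbf 1_E(x+y)\,d\mu(x)\,d\nu(y)$. $\delta_\Lambda=\sum_{\lambda\in\Lambda}\delta_\lambda$, which is a tempered distribution; $\widehat{\delta_\Lambda}$ is its distributional Fourier transform, with convention $\widehat f(\xi)=\int e^{-2\pi i\xi\cdot x}f(x)\,dx$. The support of a tempered distribution $T$ is the complement of the largest open set $V$ such that $T(\varphi)=0$ for every Schwartz function $\varphi$ supported in $V$. *)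

theory Defs
  imports "HOL-Probability.Probability"
begin

text \<open>\<open>\<mu>\<close> is a compactly supported Borel probability measure.\<close>

definition compact_borel_prob :: "(real ^ 'd) measure \<Rightarrow> bool" where
  "compact_borel_prob \<mu> \<longleftrightarrow>
     prob_space \<mu> \<and> sets \<mu> = sets borel \<and> (\<exists>K. compact K \<and> emeasure \<mu> (- K) = 0)"

text \<open>The Fourier transform of the complex measure \<open>f d\<mu>\<close>; the usual Fourier transform of a
  function is the case \<open>\<mu> = lborel\<close>.\<close>

definition fourier :: "(real ^ 'd) measure \<Rightarrow> (real ^ 'd \<Rightarrow> complex) \<Rightarrow> real ^ 'd \<Rightarrow> complex" where
  "fourier \<mu> f \<xi> = (\<integral>x. f x * exp (- 2 * of_real pi * \<i> * of_real (\<xi> \<bullet> x)) \<partial>\<mu>)"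

definition square_integrable :: "'a measure \<Rightarrow> ('a \<Rightarrow> complex) \<Rightarrow> bool" where
  "square_integrable \<mu> f \<longleftrightarrow> f \<in> borel_measurable \<mu> \<and> integrable \<mu> (\<lambda>x. (cmod (f x))\<^sup>2)"

definition tight_frame_spectrum :: "(real ^ 'd) measure \<Rightarrow> (real ^ 'd) set \<Rightarrow> bool" where
  "tight_frame_spectrum \<mu> \<Lambda> \<longleftrightarrow> countable \<Lambda> \<and>
     (\<exists>A>0. \<forall>f. square_integrable \<mu> f \<longrightarrow>
        ((\<lambda>l. (cmod (fourier \<mu> f l))\<^sup>2) has_sum (A * (\<integral>x. (cmod (f x))\<^sup>2 \<partial>\<mu>))) \<Lambda>)"

definition reflected :: "(real ^ 'd) measure \<Rightarrow> (real ^ 'd) measure" where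
  "reflected \<mu> = distr \<mu> borel uminus"

text \<open>Iterated partial derivative in the directions listed in the first argument (last one
  first). It is meaningful only where all the intermediate derivatives exist, which is what
  smoothness below requires.\<close>

primrec partials :: "'a list \<Rightarrow> ('a::euclidean_space \<Rightarrow> 'b::real_normed_vector) \<Rightarrow> 'a \<Rightarrow> 'b" where
  "partials [] f = f"
| "partials (v # vs) f = (\<lambda>x. frechet_derivative (partials vs f) (at x) v)"

text \<open>\<open>f\<close> is \<open>C\<^sup>\<infinity>\<close> on the open set \<open>U\<close>: all iterated partial derivatives exist and are
  differentiable, hence continuous, at each point of \<open>U\<close>. Values of \<open>f\<close> outside \<open>U\<close> are
  irrelevant.\<close>

definition smooth_on :: "'a set \<Rightarrow> ('a::euclidean_space \<Rightarrow> 'b::real_normed_vector) \<Rightarrow> bool" where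
  "smooth_on U f \<longleftrightarrow> (\<forall>vs\<in>lists Basis. \<forall>x\<in>U. partials vs f differentiable (at x))"

definition smooth_positive_density_on :: "(real ^ 'd) measure \<Rightarrow> (real ^ 'd) set \<Rightarrow> bool" where
  "smooth_positive_density_on \<nu> U \<longleftrightarrow>
     (\<exists>g :: real ^ 'd \<Rightarrow> real. smooth_on U g \<and> (\<forall>x\<in>U. 0 < g x) \<and>
        (\<forall>E\<in>sets borel. E \<subseteq> U \<longrightarrow> emeasure \<nu> E = (\<integral>\<^sup>+x\<in>E. ennreal (g x) \<partial>lborel)))"

definition schwartz :: "(real ^ 'd \<Rightarrow> complex) \<Rightarrow> bool" where
  "schwartz \<phi> \<longleftrightarrow> smooth_on UNIV \<phi> \<and>
     (\<forall>vs\<in>lists Basis. \<forall>k. bounded (range (\<lambda>x. norm x ^ k *\<^sub>R partials vs \<phi> x)))"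

text \<open>A distribution is represented by its action on test functions. Only its values on
  Schwartz functions matter.\<close>

type_synonym 'd dist_functional = "(real ^ 'd \<Rightarrow> complex) \<Rightarrow> complex"

text \<open>If \<open>\<Lambda>\<close> is a tight-frame spectrum of a compactly supported probability measure, then the
  number of points of \<open>\<Lambda>\<close> in unit balls is uniformly bounded, so this sum converges absolutely
  for all Schwartz functions.\<close>

definition delta_dist :: "(real ^ 'd::finite) set \<Rightarrow> 'd dist_functional" where
  "delta_dist \<Lambda> = (\<lambda>\<phi>. \<Sum>\<^sub>\<infinity>l\<in>\<Lambda>. \<phi> l)"

definition fourier_dist :: "'d::finite dist_functional \<Rightarrow> 'd dist_functional" where
  "fourier_dist T = (\<lambda>\<phi>. T (fourier lborel \<phi>))"

definition vanishes_on :: "'d::finite dist_functional \<Rightarrow> (real ^ 'd) set \<Rightarrow> bool" where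
  "vanishes_on T V \<longleftrightarrow> (\<forall>\<phi>. schwartz \<phi> \<and> closure {x. \<phi> x \<noteq> 0} \<subseteq> V \<longrightarrow> T \<phi> = 0)"

text \<open>For a tempered distribution the open sets on which it vanishes have a largest member,
  which is then necessarily their union.\<close>

definition dist_support :: "'d::finite dist_functional \<Rightarrow> (real ^ 'd) set" where
  "dist_support T = - \<Union> {V. open V \<and> vanishes_on T V}"

end

theory Submission
  imports Defs
begin

text \<open>
  Write \<open>\<nu> = \<mu> * \<mu>~\<close>, whose Fourier transform is \<open>|\<mu>^|\<^sup>2\<close>. Applied to the character
  \<open>f x = exp (2 \<pi> i t \<bullet> x)\<close>, the tight-frame identity says \<open>\<Sum>l\<in>\<Lambda>. |\<mu>^(l - t)|\<^sup>2 = A\<close> for every \<open>t\<close>: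
  the convolution of \<open>\<delta>_\<Lambda>\<close> with \<open>|\<mu>^|\<^sup>2\<close> is the constant \<open>A\<close>. On the Fourier side this reads
  \<open>\<delta>_\<Lambda>^ \<nu> = A \<delta>_0\<close>, and where \<open>\<nu>\<close> has a smooth positive density \<open>g\<close> one may divide by it, so that
  there \<open>\<delta>_\<Lambda>^\<close> is a multiple of \<open>\<delta>_0\<close>.

  The product of a distribution and a measure is avoided by moving the division to the test
  function. If \<open>\<phi>\<close> is smooth with compact support in \<open>U\<close>, then so is \<open>\<psi> = \<phi> / g\<close>
  (\<open>smooth_on_divide\<close>). Its Fourier transform \<open>\<psi>^\<close> is integrable
  (\<open>integrable_fourier_smooth_compact\<close>), hence \<open>\<psi>\<close> is recovered from it by Fourier inversion
  (\<open>fourier_inversion\<close>), and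
  \<open>\<phi>^(l) = \<integral> \<psi>(x) exp (-2 \<pi> i l \<bullet> x) d\<nu>(x) = \<integral> \<psi>^(t) |\<mu>^(l - t)|\<^sup>2 dt\<close>.
  Summing over \<open>l\<close> under the integral gives the summation formula
  \<open>\<Sum>l\<in>\<Lambda>. \<phi>^(l) = A \<integral> \<psi>^(t) dt = A \<psi>(0)\<close>
  (\<open>summation_formula\<close>), whose right-hand side vanishes as soon as \<open>\<phi>\<close> is supported away from \<open>0\<close>.
\<close>

section \<open>Smooth functions\<close>

lemma partials_cong_open:
  assumes "open U" and eq: "\<And>x. x \<in> U \<Longrightarrow> f x = g x" and "x \<in> U"
  shows "partials vs f x = partials vs g x"
  using \<open>x \<in> U\<close>
proof (induction vs arbitrary: x)
  case (Cons v vs)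
  have "(partials vs f has_derivative D) (at x) \<longleftrightarrow> (partials vs g has_derivative D) (at x)" for D
    using has_derivative_transform_within_open[OF _ \<open>open U\<close> \<open>x \<in> U\<close>] Cons.IH by metis
  then show ?case by (simp add: frechet_derivative_def)
qed (simp add: eq)

text \<open>Smoothness is proved by exhibiting a class \<open>P\<close> of functions that contains \<open>f\<close> and is closed
  under partial differentiation. Closure is asked only up to values on \<open>U\<close>, which an
  iterated derivative at a point of an open set cannot see beyond.\<close>

lemma smooth_on_coinduct:
  assumes "open U" "P f"
    and step: "\<And>u b. P u \<Longrightarrow> b \<in> Basis \<Longrightarrow>
      \<exists>h. P h \<and> (\<forall>x\<in>U. \<exists>D. (u has_derivative D) (at x) \<and> D b = h x)"
  shows "smooth_on U f"
proof -
  have diff: "u differentiable at x" if "P u" "x \<in> U" for u x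
    using step[OF that(1) SOME_Basis] that(2) by (auto simp: differentiable_def)
  have ex: "\<exists>u. P u \<and> (\<forall>x\<in>U. partials vs f x = u x)" if "vs \<in> lists Basis" for vs
    using that
  proof (induction vs)
    case Nil
    then show ?case using \<open>P f\<close> by auto
  next
    case (Cons v vs)
    then obtain u where u: "P u" "\<And>x. x \<in> U \<Longrightarrow> partials vs f x = u x" by auto
    obtain h where h: "P h" "\<And>x. x \<in> U \<Longrightarrow> \<exists>D. (u has_derivative D) (at x) \<and> D v = h x"
      using step[OF u(1)] Cons by (metis Cons_in_lists_iff)
    have "partials (v # vs) f x = h x" if x: "x \<in> U" for x
    proof -
      obtain D where D: "(u has_derivative D) (at x)" "D v = h x" using h(2)[OF x] by auto
      have "(partials vs f has_derivative D) (at x)"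
        using has_derivative_transform_within_open[OF D(1) \<open>open U\<close> x] u(2) by metis
      then show ?thesis using D(2) by (simp add: frechet_derivative_at[symmetric])
    qed
    then show ?case using h(1) by auto
  qed
  show ?thesis
    unfolding smooth_on_def
  proof (intro ballI)
    fix vs x assume vs: "vs \<in> lists (Basis :: 'a set)" and x: "x \<in> U"
    obtain u where u: "P u" "\<And>x. x \<in> U \<Longrightarrow> partials vs f x = u x" using ex[OF vs] by auto
    from diff[OF u(1) x] obtain D where "(u has_derivative D) (at x)" by (auto simp: differentiable_def)
    from has_derivative_transform_within_open[OF this \<open>open U\<close> x] u(2)
    show "partials vs f differentiable at x" unfolding differentiable_def by metis
  qed
qed

lemma smooth_on_Un: "smooth_on U f \<Longrightarrow> smooth_on V f \<Longrightarrow> smooth_on (U \<union> V) f"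
  by (auto simp: smooth_on_def)

lemma smooth_on_zero:
  assumes "open U" and "\<And>x. x \<in> U \<Longrightarrow> f x = 0"
  shows "smooth_on U f"
proof (rule smooth_on_coinduct[where P = "\<lambda>u. \<forall>x\<in>U. u x = 0"])
  fix u :: "'a \<Rightarrow> 'b" and b :: 'a assume u: "\<forall>x\<in>U. u x = 0"
  have "(u has_derivative (\<lambda>_. 0)) (at x)" if "x \<in> U" for x
    by (rule has_derivative_transform_within_open[OF has_derivative_const \<open>open U\<close> that]) (use u in auto)
  then show "\<exists>h. (\<forall>x\<in>U. h x = 0) \<and> (\<forall>x\<in>U. \<exists>D. (u has_derivative D) (at x) \<and> D b = h x)"
    by (intro exI[of _ "\<lambda>_. 0"]) auto
qed (use assms in auto)

text \<open>The class for \<open>\<phi> / g\<close>: the algebra generated by all the partial derivatives of \<open>\<phi>\<close> and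
  \<open>g\<close> together with \<open>1 / g\<close>. By the Leibniz rule and \<open>(1/g)' = - (1/g) g' (1/g)\<close>
  it is closed under differentiation, which spares any formula for higher derivatives of a
  quotient.\<close>

inductive quotient_algebra ::
  "('a::euclidean_space \<Rightarrow> complex) \<Rightarrow> ('a \<Rightarrow> real) \<Rightarrow> ('a \<Rightarrow> complex) \<Rightarrow> bool"
  for \<phi> :: "'a \<Rightarrow> complex" and g :: "'a \<Rightarrow> real" where
  numerator: "vs \<in> lists Basis \<Longrightarrow> quotient_algebra \<phi> g (partials vs \<phi>)"
| denominator: "vs \<in> lists Basis \<Longrightarrow> quotient_algebra \<phi> g (\<lambda>x. of_real (partials vs g x))"
| reciprocal: "quotient_algebra \<phi> g (\<lambda>x. of_real (inverse (g x)))"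
| minus: "quotient_algebra \<phi> g u \<Longrightarrow> quotient_algebra \<phi> g (\<lambda>x. - u x)"
| plus: "quotient_algebra \<phi> g u \<Longrightarrow> quotient_algebra \<phi> g v \<Longrightarrow> quotient_algebra \<phi> g (\<lambda>x. u x + v x)"
| times: "quotient_algebra \<phi> g u \<Longrightarrow> quotient_algebra \<phi> g v \<Longrightarrow> quotient_algebra \<phi> g (\<lambda>x. u x * v x)"

lemma smooth_on_divide:
  fixes \<phi> :: "'a::euclidean_space \<Rightarrow> complex"
  assumes "open U" "smooth_on U \<phi>" "smooth_on U g" and pos: "\<And>x. x \<in> U \<Longrightarrow> g x \<noteq> 0"
  shows "smooth_on U (\<lambda>x. \<phi> x / of_real (g x))"
proof (rule smooth_on_coinduct[where P = "quotient_algebra \<phi> g"])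
  have d\<phi>: "(partials vs \<phi> has_derivative frechet_derivative (partials vs \<phi>) (at x)) (at x)"
    and dg: "(partials vs g has_derivative frechet_derivative (partials vs g) (at x)) (at x)"
    if "vs \<in> lists Basis" "x \<in> U" for vs x
    using assms that by (auto simp: smooth_on_def frechet_derivative_works)
  have "quotient_algebra \<phi> g (\<lambda>x. partials [] \<phi> x * of_real (inverse (g x)))"
    by (intro quotient_algebra.intros) auto
  then show "quotient_algebra \<phi> g (\<lambda>x. \<phi> x / of_real (g x))"
    by (simp add: divide_inverse)
  fix u and b :: 'a
  assume "quotient_algebra \<phi> g u" and b: "b \<in> Basis"
  then show "\<exists>h. quotient_algebra \<phi> g h \<and> (\<forall>x\<in>U. \<exists>D. (u has_derivative D) (at x) \<and> D b = h x)"
  proof induction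
    case (numerator vs)
    then show ?case
      using d\<phi> b quotient_algebra.numerator[of "b # vs" \<phi> g]
      by (intro exI[of _ "partials (b # vs) \<phi>"]) auto
  next
    case (denominator vs)
    then show ?case
      using dg b has_derivative_of_real
      by (intro exI[of _ "\<lambda>x. of_real (partials (b # vs) g x)"])
        (fastforce intro!: quotient_algebra.denominator)
  next
    case reciprocal
    let ?r = "\<lambda>x. of_real (inverse (g x)) :: complex"
    show ?case
    proof (intro exI conjI ballI)
      show "quotient_algebra \<phi> g (\<lambda>x. - (?r x * of_real (partials [b] g x) * ?r x))"
        using b by (intro quotient_algebra.intros) auto
      fix x assume x: "x \<in> U"
      show "(?r has_derivative
          (\<lambda>h. of_real (- (inverse (g x) * frechet_derivative g (at x) h * inverse (g x))))) (at x)"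
        using dg[of "[]" x] x pos by (intro has_derivative_of_real Deriv.has_derivative_inverse) auto
    qed simp
  next
    case (minus u)
    then obtain h where h: "quotient_algebra \<phi> g h" "\<forall>x\<in>U. \<exists>D. (u has_derivative D) (at x) \<and> D b = h x" by auto
    have "\<exists>D. ((\<lambda>x. - u x) has_derivative D) (at x) \<and> D b = - h x" if x: "x \<in> U" for x
    proof -
      obtain D where "(u has_derivative D) (at x)" "D b = h x" using h x by auto
      then show ?thesis by (intro exI[of _ "\<lambda>y. - D y"]) (auto intro: has_derivative_minus)
    qed
    then show ?case using h by (intro exI[of _ "\<lambda>x. - h x"]) (auto intro: quotient_algebra.intros)
  next
    case (plus u v)
    then obtain h k where h: "quotient_algebra \<phi> g h" "\<forall>x\<in>U. \<exists>D. (u has_derivative D) (at x) \<and> D b = h x"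
      and k: "quotient_algebra \<phi> g k" "\<forall>x\<in>U. \<exists>D. (v has_derivative D) (at x) \<and> D b = k x" by auto
    have "\<exists>D. ((\<lambda>x. u x + v x) has_derivative D) (at x) \<and> D b = h x + k x" if x: "x \<in> U" for x
    proof -
      obtain D E where "(u has_derivative D) (at x)" "D b = h x" "(v has_derivative E) (at x)" "E b = k x"
        using h k x by meson
      then show ?thesis by (intro exI[of _ "\<lambda>y. D y + E y"]) (auto intro: has_derivative_add)
    qed
    then show ?case using h k by (intro exI[of _ "\<lambda>x. h x + k x"]) (auto intro: quotient_algebra.intros)
  next
    case (times u v)
    then obtain h k where h: "quotient_algebra \<phi> g h" "\<forall>x\<in>U. \<exists>D. (u has_derivative D) (at x) \<and> D b = h x"
      and k: "quotient_algebra \<phi> g k" "\<forall>x\<in>U. \<exists>D. (v has_derivative D) (at x) \<and> D b = k x" by auto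
    have "\<exists>D. ((\<lambda>x. u x * v x) has_derivative D) (at x) \<and> D b = u x * k x + h x * v x" if x: "x \<in> U" for x
    proof -
      obtain D E where "(u has_derivative D) (at x)" "D b = h x" "(v has_derivative E) (at x)" "E b = k x"
        using h k x by meson
      then show ?thesis by (intro exI[of _ "\<lambda>y. u x * E y + D y * v x"]) (auto intro: has_derivative_mult)
    qed
    then show ?case using h k times.hyps
      by (intro exI[of _ "\<lambda>x. u x * k x + h x * v x"]) (auto intro: quotient_algebra.intros)
  qed
qed (rule \<open>open U\<close>)

lemma partials_zero: "partials vs (\<lambda>_. 0) = (\<lambda>_. 0)"
proof (induction vs)
  case (Cons v vs)
  have "((\<lambda>_. 0) has_derivative (\<lambda>_. 0)) (at x)" for x :: 'a by simp
  then show ?case using Cons by (simp add: frechet_derivative_at[symmetric])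
qed simp

lemma partials_outside_support:
  assumes "closed K" "\<And>x. x \<notin> K \<Longrightarrow> f x = 0" "x \<notin> K"
  shows "partials vs f x = 0"
  using partials_cong_open[of "- K" f "\<lambda>_. 0" x vs] assms by (simp add: partials_zero open_closed)

lemma continuous_on_partials:
  assumes "smooth_on U f" "vs \<in> lists Basis"
  shows "continuous_on U (partials vs f)"
  using assms unfolding smooth_on_def
  by (intro continuous_at_imp_continuous_on ballI differentiable_imp_continuous_within) blast

section \<open>Fourier transforms of compactly supported functions\<close>

lemma fourier_cis: "fourier M f \<xi> = (\<integral>x. f x * cis (- (2 * pi * (\<xi> \<bullet> x))) \<partial>M)"
  by (simp add: fourier_def cis_conv_exp mult_ac)

lemma measurable_cis [measurable]: "cis \<in> borel_measurable borel"
  by (intro borel_measurable_continuous_onI continuous_intros)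

lemma integrable_mult_cis:
  assumes "integrable M f" "\<theta> \<in> borel_measurable M"
  shows "integrable M (\<lambda>x. f x * cis (\<theta> x))"
  using assms by (intro Bochner_Integration.integrable_bound[OF assms(1)]) (auto simp: norm_mult)

lemma integrable_compact_support:
  fixes f :: "'a::euclidean_space \<Rightarrow> complex"
  assumes "compact K" "continuous_on UNIV f" "\<And>x. x \<notin> K \<Longrightarrow> f x = 0"
  shows "integrable lborel f"
proof -
  have "integrable lborel (\<lambda>x. indicator K x *\<^sub>R f x)"
    using assms by (intro borel_integrable_compact) (auto intro: continuous_on_subset)
  also have "(\<lambda>x. indicator K x *\<^sub>R f x) = f"
    using assms(3) by (auto simp: indicator_def)
  finally show ?thesis .
qed

lemma bounded_compact_support:
  assumes "compact K" "continuous_on UNIV f" "\<And>x. x \<notin> K \<Longrightarrow> f x = 0"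
  shows "bounded (range f)"
proof (rule bounded_subset)
  show "bounded (insert 0 (f ` K))"
    using assms by (auto intro!: compact_imp_bounded compact_continuous_image intro: continuous_on_subset)
  show "range f \<subseteq> insert 0 (f ` K)" using assms(3) by blast
qed

lemma
  fixes f :: "'a::euclidean_space \<Rightarrow> 'b::{banach,second_countable_topology}"
  assumes [measurable]: "f \<in> borel_measurable borel" and "c \<noteq> 0"
  shows lborel_integral_affine:
      "(\<integral>x. f x \<partial>lborel) = \<bar>c\<bar> ^ DIM('a) *\<^sub>R (\<integral>x. f (t + c *\<^sub>R x) \<partial>lborel)"
    and lborel_integrable_affine_iff:
      "integrable lborel (\<lambda>x. f (t + c *\<^sub>R x)) \<longleftrightarrow> integrable lborel f"
proof -
  let ?M = "density (distr lborel borel (\<lambda>x. t + c *\<^sub>R x)) (\<lambda>_. \<bar>c\<bar> ^ DIM('a))"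
  have M: "lborel = ?M" using lborel_affine[OF \<open>c \<noteq> 0\<close>, of t] by simp
  have "integral\<^sup>L ?M f = \<bar>c\<bar> ^ DIM('a) *\<^sub>R (\<integral>x. f (t + c *\<^sub>R x) \<partial>lborel)"
    by (subst integral_density) (auto simp: integral_distr)
  then show "(\<integral>x. f x \<partial>lborel) = \<bar>c\<bar> ^ DIM('a) *\<^sub>R (\<integral>x. f (t + c *\<^sub>R x) \<partial>lborel)"
    by (simp flip: M)
  have "integrable ?M f \<longleftrightarrow> integrable lborel (\<lambda>x. f (t + c *\<^sub>R x))"
    using \<open>c \<noteq> 0\<close> integrable_scaleR_right[of "inverse (\<bar>c\<bar> ^ DIM('a))" lborel
      "\<lambda>x. \<bar>c\<bar> ^ DIM('a) *\<^sub>R f (t + c *\<^sub>R x)"]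
    by (subst integrable_density) (auto simp: integrable_distr_eq)
  then show "integrable lborel (\<lambda>x. f (t + c *\<^sub>R x)) \<longleftrightarrow> integrable lborel f"
    by (simp flip: M)
qed

lemma difference_quotient_tendsto:
  assumes "(u has_vector_derivative d) (at 0)"
  shows "((\<lambda>s. (u s - u 0) /\<^sub>R s) \<longlongrightarrow> d) (at 0)"
proof (rule LIM_zero_cancel, rule tendsto_norm_zero_cancel)
  have lim: "((\<lambda>s. norm (u s - u 0 - s *\<^sub>R d) / norm s) \<longlongrightarrow> 0) (at 0)"
    using assms by (simp add: has_vector_derivative_def has_derivative_at)
  have eq: "norm (u s - u 0 - s *\<^sub>R d) / norm s = norm ((u s - u 0) /\<^sub>R s - d)" if "s \<noteq> 0" for s
  proof -
    have "(u s - u 0) /\<^sub>R s - d = (u s - u 0 - s *\<^sub>R d) /\<^sub>R s"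
      using that by (simp add: scaleR_right_diff_distrib)
    then show ?thesis by (simp add: divide_inverse)
  qed
  show "((\<lambda>s. norm ((u s - u 0) /\<^sub>R s - d)) \<longlongrightarrow> 0) (at 0)"
    by (rule Lim_transform_eventually[OF lim]) (use eq in \<open>auto simp: eventually_at intro!: exI[of _ 1]\<close>)
qed

text \<open>Differentiation becomes multiplication without integrating by parts: the translate
  \<open>f (x + h v)\<close> has Fourier transform \<open>exp (2 \<pi> i h \<xi> \<bullet> v) f^(\<xi>)\<close>, so the identity is exact for
  difference quotients. These are bounded by the supremum of the derivative and, for
  \<open>h \<le> 1\<close>, supported in one ball, so dominated convergence applies as \<open>h \<rightarrow> 0\<close>.\<close>

lemma fourier_derivative:
  fixes f :: "real ^ 'd \<Rightarrow> complex"
  assumes diff: "\<And>x. f differentiable at x"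
    and cont: "continuous_on UNIV (\<lambda>x. frechet_derivative f (at x) v)"
    and K: "compact K" and supp: "\<And>x. x \<notin> K \<Longrightarrow> f x = 0"
  shows "fourier lborel (\<lambda>x. frechet_derivative f (at x) v) \<xi>
    = 2 * pi * \<i> * (\<xi> \<bullet> v) * fourier lborel f \<xi>"
proof -
  let ?e = "\<lambda>x. cis (- (2 * pi * (\<xi> \<bullet> x)))"
  define f' where "f' = (\<lambda>x. frechet_derivative f (at x) v)"
  define h :: "nat \<Rightarrow> real" where "h n = inverse (Suc n)" for n
  have h: "0 < h n" "h n \<le> 1" for n by (auto simp: h_def field_simps)
  have h0: "h \<longlonglongrightarrow> 0" unfolding h_def by (rule LIMSEQ_inverse_real_of_nat)
  have h_at: "filterlim h (at 0) sequentially"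
    using h0 less_imp_neq[OF h(1)] by (auto simp: filterlim_at intro!: always_eventually)
  define q where "q n x = (f (x + h n *\<^sub>R v) - f x) /\<^sub>R h n" for n x
  have fcont: "continuous_on UNIV f"
    using diff by (auto intro!: continuous_at_imp_continuous_on differentiable_imp_continuous_within)
  have [measurable]: "f \<in> borel_measurable borel" "f' \<in> borel_measurable borel"
    using fcont cont by (auto intro: borel_measurable_continuous_onI simp: f'_def)
  have f'0: "f' x = 0" if "x \<notin> K" for x
    using partials_outside_support[of K f x "[v]"] that supp K by (simp add: f'_def compact_imp_closed)
  have intf: "integrable lborel f"
    using K fcont supp by (rule integrable_compact_support)
  obtain B where B: "\<And>x. norm (f' x) \<le> B"
    using bounded_compact_support[OF K, of f'] cont f'0 unfolding f'_def bounded_iff by auto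
  obtain R where R: "\<And>x. x \<in> K \<Longrightarrow> norm x \<le> R" using K by (meson compact_imp_bounded bounded_iff)
  have line: "((\<lambda>s. f (x + s *\<^sub>R v)) has_vector_derivative f' (x + s *\<^sub>R v)) (at s within S)" for x s S
  proof -
    let ?D = "frechet_derivative f (at (x + s *\<^sub>R v))"
    have D: "(f has_derivative ?D) (at (x + s *\<^sub>R v))"
      using diff by (simp add: frechet_derivative_works)
    have "((\<lambda>s. x + s *\<^sub>R v) has_derivative (\<lambda>r. r *\<^sub>R v)) (at s within S)"
      by (auto intro!: derivative_eq_intros)
    from has_derivative_compose[OF this D] show ?thesis
      using linear_scale[OF has_derivative_linear[OF D]]
      by (simp add: has_vector_derivative_def f'_def)
  qed
  \<comment> \<open>The dominating function: mean value inequality inside the ball, zero outside.\<close>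
  have qbound: "norm (q n x) \<le> B * indicator (cball 0 (R + norm v)) x" for n x
  proof (cases "norm x \<le> R + norm v")
    case True
    have "norm (f (x + h n *\<^sub>R v) - f (x + 0 *\<^sub>R v)) \<le> B * norm (h n - 0)"
      by (rule differentiable_bound[of "{0..1}" _ "\<lambda>s t. t *\<^sub>R f' (x + s *\<^sub>R v)"])
        (use h line[unfolded has_vector_derivative_def] B in
          \<open>auto intro!: onorm_le simp: less_imp_le mult.commute[of B] mult_left_mono\<close>)
    then show ?thesis using True h[of n] by (simp add: q_def divide_simps)
  next
    case False
    have "norm x \<le> norm (x + h n *\<^sub>R v) + norm (h n *\<^sub>R v)"
      using norm_triangle_ineq4[of "x + h n *\<^sub>R v" "h n *\<^sub>R v"] by simp
    moreover have "norm (h n *\<^sub>R v) \<le> norm v" using h[of n] by (simp add: mult_left_le_one_le)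
    ultimately have "x + h n *\<^sub>R v \<notin> K" "x \<notin> K"
      using R False norm_ge_zero[of v] by fastforce+
    then show ?thesis using supp False by (simp add: q_def)
  qed
  have qlim: "(\<lambda>n. q n x) \<longlonglongrightarrow> f' x" for x
  proof -
    have "((\<lambda>s. (f (x + s *\<^sub>R v) - f (x + 0 *\<^sub>R v)) /\<^sub>R s) \<longlongrightarrow> f' (x + 0 *\<^sub>R v)) (at 0)"
      by (rule difference_quotient_tendsto) (rule line)
    from filterlim_compose[OF this h_at] show ?thesis by (simp add: q_def)
  qed
  have lim1: "(\<lambda>n. fourier lborel (q n) \<xi>) \<longlonglongrightarrow> fourier lborel f' \<xi>"
    unfolding fourier_cis
  proof (rule integral_dominated_convergence[where w = "\<lambda>x. B * indicator (cball 0 (R + norm v)) x"])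
    show "integrable lborel (\<lambda>x::real^'d. B * indicator (cball 0 (R + norm v)) x)"
      by (intro integrable_mult_right integrable_real_indicator)
        (use emeasure_bounded_finite[OF bounded_cball] in \<open>auto simp: top.not_eq_extremum infinity_ennreal_def\<close>)
    show "AE x in lborel. (\<lambda>n. q n x * ?e x) \<longlonglongrightarrow> f' x * ?e x"
      by (intro always_eventually allI tendsto_intros qlim)
    show "AE x in lborel. norm (q n x * ?e x) \<le> B * indicator (cball 0 (R + norm v)) x" for n
      using qbound by (simp add: norm_mult)
  qed (auto simp: q_def)
  have eq: "fourier lborel (q n) \<xi> = (cis (2 * pi * (\<xi> \<bullet> v) * h n) - 1) /\<^sub>R h n * fourier lborel f \<xi>" for n
  proof -
    have i1: "integrable lborel (\<lambda>x. f x * ?e x)" using intf by (intro integrable_mult_cis) auto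
    have i2: "integrable lborel (\<lambda>x. f (h n *\<^sub>R v + 1 *\<^sub>R x) * ?e (h n *\<^sub>R v + 1 *\<^sub>R x))"
      using i1 by (subst lborel_integrable_affine_iff[of "\<lambda>x. f x * ?e x"]) auto
    have lin: "(\<integral>x. (c * k x - l x) /\<^sub>R r \<partial>lborel) = (c * (\<integral>x. k x \<partial>lborel) - (\<integral>x. l x \<partial>lborel)) /\<^sub>R r"
      if "integrable lborel k" "integrable lborel l" for c :: complex and k l :: "real ^ 'd \<Rightarrow> complex" and r
      using that by simp
    have shift: "fourier lborel f \<xi> = (\<integral>x. f (h n *\<^sub>R v + 1 *\<^sub>R x) * ?e (h n *\<^sub>R v + 1 *\<^sub>R x) \<partial>lborel)"
      unfolding fourier_cis by (subst lborel_integral_affine[of _ 1 "h n *\<^sub>R v"]) auto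
    have "fourier lborel (q n) \<xi> = (\<integral>x. (cis (2 * pi * (\<xi> \<bullet> v) * h n) *
       (f (h n *\<^sub>R v + 1 *\<^sub>R x) * ?e (h n *\<^sub>R v + 1 *\<^sub>R x)) - f x * ?e x) /\<^sub>R h n \<partial>lborel)"
      unfolding fourier_cis q_def
      by (intro Bochner_Integration.integral_cong)
       (auto simp: algebra_simps cis_mult inner_add_right)
    also have "\<dots> = (cis (2 * pi * (\<xi> \<bullet> v) * h n) * fourier lborel f \<xi> - fourier lborel f \<xi>) /\<^sub>R h n"
      using lin[OF i2 i1] by (simp only: shift[symmetric] fourier_cis[symmetric])
    finally show ?thesis by (simp add: algebra_simps)
  qed
  have "((\<lambda>s. cis (2 * pi * (\<xi> \<bullet> v) * s)) has_vector_derivative 2 * pi * \<i> * (\<xi> \<bullet> v)) (at 0)"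
    unfolding has_vector_derivative_def
    by (rule has_derivative_eq_rhs, (rule derivative_eq_intros refl)+)
      (auto simp: fun_eq_iff scaleR_conv_of_real mult_ac)
  from difference_quotient_tendsto[OF this]
  have "((\<lambda>s. (cis (2 * pi * (\<xi> \<bullet> v) * s) - 1) /\<^sub>R s) \<longlongrightarrow> 2 * pi * \<i> * (\<xi> \<bullet> v)) (at 0)"
    by simp
  from filterlim_compose[OF this h_at]
  have "(\<lambda>n. (cis (2 * pi * (\<xi> \<bullet> v) * h n) - 1) /\<^sub>R h n * fourier lborel f \<xi>) \<longlonglongrightarrow> 2 * pi * \<i> * (\<xi> \<bullet> v) * fourier lborel f \<xi>"
    by (intro tendsto_intros) simp
  with lim1 eq show ?thesis unfolding f'_def by (simp add: LIMSEQ_unique)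
qed

text \<open>Fubini for functions that split along the coordinates; it serves both the weight that
  controls the decay of Fourier transforms and the Gaussian.\<close>

lemma
  fixes f :: "'a::euclidean_space \<Rightarrow> real \<Rightarrow> 'b::{real_normed_field,banach,second_countable_topology}"
  assumes "\<And>b. b \<in> Basis \<Longrightarrow> integrable lborel (f b)"
  shows lborel_integrable_prod: "integrable lborel (\<lambda>x. \<Prod>b\<in>Basis. f b (x \<bullet> b))"
    and lborel_integral_prod: "(\<integral>x. (\<Prod>b\<in>Basis. f b (x \<bullet> b)) \<partial>lborel) = (\<Prod>b\<in>Basis. \<integral>t. f b t \<partial>lborel)"
proof -
  interpret product_sigma_finite "\<lambda>_::'a. lborel :: real measure" ..
  have [measurable]: "f b \<in> borel_measurable borel" if "b \<in> Basis" for b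
    using assms[OF that] by (auto dest: borel_measurable_integrable)
  let ?P = "\<Pi>\<^sub>M b\<in>(Basis::'a set). (lborel :: real measure)"
  let ?T = "\<lambda>y. \<Sum>b\<in>Basis. y b *\<^sub>R b :: 'a"
  have [measurable]: "(\<lambda>x::'a. \<Prod>b\<in>Basis. f b (x \<bullet> b)) \<in> borel_measurable borel"
    by (intro borel_measurable_prod) (auto intro!: measurable_compose[of _ _ borel])
  have coord: "(\<Prod>b\<in>Basis. f b (?T y \<bullet> b)) = (\<Prod>b\<in>Basis. f b (y b))" for y
    by (intro prod.cong) auto
  have T: "?T \<in> measurable ?P borel" by measurable
  have "integrable ?P (\<lambda>y. \<Prod>b\<in>Basis. f b (y b))"
    using assms by (intro product_integrable_prod) auto
  then have "integrable (distr ?P borel ?T) (\<lambda>x. \<Prod>b\<in>Basis. f b (x \<bullet> b))"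
    using T by (subst integrable_distr_eq) (auto simp: coord)
  then show "integrable lborel (\<lambda>x. \<Prod>b\<in>Basis. f b (x \<bullet> b))" by (simp add: lborel_eq[symmetric])
  have "(\<integral>x. (\<Prod>b\<in>Basis. f b (x \<bullet> b)) \<partial>distr ?P borel ?T) = (\<integral>y. (\<Prod>b\<in>Basis. f b (y b)) \<partial>?P)"
    using T by (subst integral_distr) (auto simp: coord)
  also have "\<dots> = (\<Prod>b\<in>Basis. \<integral>t. f b t \<partial>lborel)"
    using assms by (intro product_integral_prod) auto
  finally show "(\<integral>x. (\<Prod>b\<in>Basis. f b (x \<bullet> b)) \<partial>lborel) = (\<Prod>b\<in>Basis. \<integral>t. f b t \<partial>lborel)"
    by (simp add: lborel_eq[symmetric])
qed

lemma integrable_prod_inverse_1_plus_square: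
  "integrable lborel (\<lambda>x::'a::euclidean_space. \<Prod>b\<in>Basis. inverse (1 + (x \<bullet> b)\<^sup>2))"
  using lborel_integrable_prod[where f = "\<lambda>_::'a. \<lambda>t. inverse (1 + t\<^sup>2) :: real"] integrable_inverse_1_plus_square
  by (simp add: set_integrable_def einterval_def)

text \<open>Each factor \<open>1 + \<xi>_b\<^sup>2\<close> is paid for by two derivatives in the direction \<open>b\<close>, since the
  Fourier transform of a compactly supported continuous function is bounded. Doing this for all coordinates
  bounds \<open>f^(\<xi>)\<close> by a multiple of \<open>\<Prod>b. 1 / (1 + \<xi>_b\<^sup>2)\<close>, which is integrable.\<close>

lemma integrable_fourier_smooth_compact:
  fixes f :: "real ^ 'd \<Rightarrow> complex"
  assumes smooth: "smooth_on UNIV f" and K: "compact K" and supp: "\<And>x. x \<notin> K \<Longrightarrow> f x = 0"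
  shows "integrable lborel (fourier lborel f)"
proof -
  have pcont: "continuous_on UNIV (partials vs f)" if "vs \<in> lists Basis" for vs
    using continuous_on_partials smooth that by blast
  have psupp: "partials vs f x = 0" if "x \<notin> K" for vs x
    using partials_outside_support[of K f] supp that K by (auto simp: compact_imp_closed)
  have pint: "integrable lborel (partials vs f)" if "vs \<in> lists Basis" for vs
    using integrable_compact_support[OF K pcont] psupp that by blast
  have deriv: "fourier lborel (partials (v # vs) f) \<xi> = 2 * pi * \<i> * (\<xi> \<bullet> v) * fourier lborel (partials vs f) \<xi>"
    if "v \<in> Basis" "vs \<in> lists Basis" for v vs \<xi>
    using fourier_derivative[of "partials vs f" v K \<xi>] pcont[of "v # vs"] smooth psupp K that
    by (simp add: smooth_on_def)
  \<comment> \<open>The claim is for all iterated derivatives at once, because adding a coordinate to \<open>S\<close>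
    uses the case of two further derivatives.\<close>
  have decay: "\<exists>C. \<forall>\<xi>. norm (fourier lborel (partials vs f) \<xi>) * (\<Prod>b\<in>S. 1 + (\<xi> \<bullet> b)\<^sup>2) \<le> C"
    if "finite S" "S \<subseteq> Basis" "vs \<in> lists Basis" for S vs
    using that
  proof (induction S arbitrary: vs rule: finite_induct)
    case empty
    have "norm (fourier lborel (partials vs f) \<xi>) \<le> (\<integral>x. norm (partials vs f x) \<partial>lborel)" for \<xi>
      using integral_norm_bound[of lborel "\<lambda>x. partials vs f x * cis (- (2 * pi * (\<xi> \<bullet> x)))"]
      by (simp add: fourier_cis norm_mult)
    then show ?case by auto
  next
    case (insert b S)
    let ?F = "\<lambda>vs \<xi>. norm (fourier lborel (partials vs f) \<xi>)"
    let ?w = "\<lambda>\<xi>. \<Prod>b\<in>S. 1 + (\<xi> \<bullet> b)\<^sup>2"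
    obtain C where C: "?F vs \<xi> * ?w \<xi> \<le> C" for \<xi>
      using insert.IH[of vs] insert.prems by auto
    obtain D where D: "?F (b # b # vs) \<xi> * ?w \<xi> \<le> D" for \<xi>
      using insert.IH[of "b # b # vs"] insert.prems by auto
    have "?F vs \<xi> * (\<Prod>b\<in>insert b S. 1 + (\<xi> \<bullet> b)\<^sup>2) \<le> C + D" for \<xi>
    proof -
      have w: "0 \<le> ?w \<xi>" by (intro prod_nonneg) auto
      have "?F (b # b # vs) \<xi> = (2 * pi)\<^sup>2 * (\<xi> \<bullet> b)\<^sup>2 * ?F vs \<xi>"
        using insert.prems deriv[of b "b # vs" \<xi>] deriv[of b vs \<xi>]
        by (simp add: norm_mult power2_eq_square abs_mult_self_eq)
      moreover have "1 * ((\<xi> \<bullet> b)\<^sup>2 * ?F vs \<xi>) \<le> (2 * pi)\<^sup>2 * ((\<xi> \<bullet> b)\<^sup>2 * ?F vs \<xi>)"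
        using pi_ge_two by (intro mult_right_mono one_le_power) auto
      ultimately have "(1 + (\<xi> \<bullet> b)\<^sup>2) * ?F vs \<xi> \<le> ?F vs \<xi> + ?F (b # b # vs) \<xi>"
        by (simp add: algebra_simps)
      from mult_right_mono[OF this w] show ?thesis
        using C[of \<xi>] D[of \<xi>] insert.hyps by (simp add: algebra_simps)
    qed
    then show ?case by blast
  qed
  obtain C where C: "norm (fourier lborel f \<xi>) * (\<Prod>b\<in>Basis. 1 + (\<xi> \<bullet> b)\<^sup>2) \<le> C" for \<xi>
    using decay[of Basis "[]"] by auto
  have intf: "integrable lborel f" using pint[of "[]"] by simp
  then have [measurable]: "f \<in> borel_measurable borel" by (simp add: integrable_iff_bounded)
  show ?thesis
  proof (rule Bochner_Integration.integrable_bound[OF integrable_mult_right[OF integrable_prod_inverse_1_plus_square]])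
    show "fourier lborel f \<in> borel_measurable lborel"
      unfolding fourier_cis[abs_def] by measurable
    show "AE \<xi> in lborel. norm (fourier lborel f \<xi>) \<le> norm (C * (\<Prod>b\<in>Basis. inverse (1 + (\<xi> \<bullet> b)\<^sup>2)))"
    proof (intro always_eventually allI)
      fix \<xi> :: "real ^ 'd"
      have pos: "0 < (\<Prod>b\<in>Basis. 1 + (\<xi> \<bullet> b)\<^sup>2)" by (intro prod_pos) (auto intro: add_pos_nonneg)
      then have "norm (fourier lborel f \<xi>) \<le> C * inverse (\<Prod>b\<in>Basis. 1 + (\<xi> \<bullet> b)\<^sup>2)"
        using C[of \<xi>] by (simp add: field_simps)
      then show "norm (fourier lborel f \<xi>) \<le> norm (C * (\<Prod>b\<in>Basis. inverse (1 + (\<xi> \<bullet> b)\<^sup>2)))"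
        by (simp add: prod_inversef[symmetric] o_def)
    qed
  qed
qed

section \<open>Fourier inversion\<close>

text \<open>The normalisation with \<open>\<pi>\<close> in the exponent makes this function its own Fourier transform
  and a probability density.\<close>

definition gaussian :: "'a::euclidean_space \<Rightarrow> real" where
  "gaussian x = exp (- pi * (norm x)\<^sup>2)"

lemma gaussian_measurable [measurable]: "gaussian \<in> borel_measurable borel"
  unfolding gaussian_def[abs_def] by measurable

text \<open>This is the characteristic function of the standard normal distribution after rescaling
  by \<open>sqrt (2 \<pi>)\<close>.\<close>

lemma fourier_gaussian_real:
  fixes s :: real
  shows "integrable lborel (\<lambda>t. of_real (exp (- (pi * t\<^sup>2))) * cis (2 * pi * s * t))"
    and "(\<integral>t. of_real (exp (- (pi * t\<^sup>2))) * cis (2 * pi * s * t) \<partial>lborel) = of_real (exp (- (pi * s\<^sup>2)))"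
proof -
  define r where "r = sqrt (2 * pi)"
  have r: "0 < r" "r * r = 2 * pi" by (auto simp: r_def)
  define G where "G t = of_real (std_normal_density t) * cis (r * s * t)" for t
  have intG: "integrable lborel G"
    unfolding G_def by (intro integrable_mult_cis integrable_of_real integrable_normal_density) auto
  have "integral\<^sup>L lborel G = char std_normal_distribution (r * s)"
    unfolding char_def G_def
    by (subst integral_density) (auto simp: cis_conv_exp scaleR_conv_of_real)
  also have "\<dots> = of_real (exp (- (pi * s\<^sup>2)))"
    unfolding char_std_normal_distribution using r(2) by (simp add: power_mult_distrib power2_eq_square)
  finally have valG: "integral\<^sup>L lborel G = of_real (exp (- (pi * s\<^sup>2)))" .
  have G_r: "r *\<^sub>R G (0 + r * t) = of_real (exp (- (pi * t\<^sup>2))) * cis (2 * pi * s * t)" for t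
  proof -
    have dens: "r * std_normal_density (r * t) = exp (- (pi * t\<^sup>2))"
      using r by (simp add: normal_density_def r_def[symmetric] power_mult_distrib power2_eq_square)
    have arg: "r * s * (r * t) = 2 * pi * s * t" using r(2) by (simp add: algebra_simps)
    have "r *\<^sub>R G (0 + r * t) = of_real (r * std_normal_density (r * t)) * cis (r * s * (r * t))"
      by (simp add: G_def scaleR_conv_of_real)
    then show ?thesis by (simp only: dens arg)
  qed
  show "integrable lborel (\<lambda>t. of_real (exp (- (pi * t\<^sup>2))) * cis (2 * pi * s * t))"
    using lborel_integrable_real_affine[OF intG, of r 0] r G_r by (metis (no_types, lifting) ext integrable_scaleR_right less_irrefl)
  show "(\<integral>t. of_real (exp (- (pi * t\<^sup>2))) * cis (2 * pi * s * t) \<partial>lborel) = of_real (exp (- (pi * s\<^sup>2)))"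
    using lborel_integral_real_affine[of r G 0] r valG unfolding G_r[symmetric] by simp
qed

lemma power2_norm_eq_sum_Basis: "(norm (x::'a::euclidean_space))\<^sup>2 = (\<Sum>b\<in>Basis. (x \<bullet> b)\<^sup>2)"
  unfolding power2_norm_eq_inner by (subst euclidean_inner) (simp add: power2_eq_square)

lemma cis_sum: "finite I \<Longrightarrow> cis (\<Sum>i\<in>I. \<theta> i) = (\<Prod>i\<in>I. cis (\<theta> i))"
  by (simp add: cis_conv_exp sum_distrib_left exp_sum)

lemma fourier_gaussian:
  fixes s :: "'a::euclidean_space"
  shows "integrable lborel (\<lambda>t. of_real (gaussian t) * cis (2 * pi * (s \<bullet> t)))"
    and "(\<integral>t. of_real (gaussian t) * cis (2 * pi * (s \<bullet> t)) \<partial>lborel) = of_real (gaussian s)"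
proof -
  let ?f = "\<lambda>b t. of_real (exp (- (pi * t\<^sup>2))) * cis (2 * pi * (s \<bullet> b) * t)"
  have eq: "of_real (gaussian t) * cis (2 * pi * (s \<bullet> t)) = (\<Prod>b\<in>Basis. ?f b (t \<bullet> b))" for t
  proof -
    have "2 * pi * (s \<bullet> t) = (\<Sum>b\<in>Basis. 2 * pi * (s \<bullet> b) * (t \<bullet> b))"
      by (subst euclidean_inner) (simp add: sum_distrib_left mult_ac)
    then show ?thesis
      by (simp add: gaussian_def power2_norm_eq_sum_Basis sum_negf[symmetric] sum_distrib_left exp_sum cis_sum prod.distrib)
  qed
  show "integrable lborel (\<lambda>t. of_real (gaussian t) * cis (2 * pi * (s \<bullet> t)))"
    unfolding eq by (intro lborel_integrable_prod fourier_gaussian_real)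
  show "(\<integral>t. of_real (gaussian t) * cis (2 * pi * (s \<bullet> t)) \<partial>lborel) = of_real (gaussian s)"
    unfolding eq by (subst lborel_integral_prod)
      (simp_all add: fourier_gaussian_real gaussian_def power2_norm_eq_sum_Basis sum_negf[symmetric] sum_distrib_left exp_sum
        del: of_real_exp)
qed

text \<open>Insert the factor \<open>gaussian (\<epsilon> t)\<close> into the inversion integral. As \<open>\<epsilon> \<rightarrow> 0\<close> it tends to
  \<open>1\<close> and the integral converges to the one without the factor, by integrability of \<open>f^\<close>. For fixed \<open>\<epsilon>\<close> Fubini
  and self-duality of the Gaussian turn the integral into the average
  \<open>\<integral> f (x - \<epsilon> z) gaussian z dz\<close>, which tends to \<open>f x\<close> by continuity at \<open>x\<close>.\<close>

lemma fourier_inversion: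
  fixes f :: "real ^ 'd \<Rightarrow> complex"
  assumes int: "integrable lborel f" and cont: "isCont f x" and bdd: "bounded (range f)"
    and intF: "integrable lborel (fourier lborel f)"
  shows "(\<integral>t. fourier lborel f t * cis (2 * pi * (t \<bullet> x)) \<partial>lborel) = f x"
proof -
  let ?F = "fourier lborel f" and ?d = "DIM(real ^ 'd)"
  have [measurable]: "f \<in> borel_measurable borel" "?F \<in> borel_measurable borel"
    using int intF by (auto simp: integrable_iff_bounded)
  have int_gauss: "integrable lborel (\<lambda>t::real^'d. of_real (gaussian t) :: complex)"
    using fourier_gaussian(1)[of 0] by simp
  then have int_gauss_real: "integrable lborel (gaussian :: real ^ 'd \<Rightarrow> real)"
    using integrable_Re by fastforce
  define e :: "nat \<Rightarrow> real" where "e n = inverse (Suc n)" for n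
  have e: "0 < e n" for n by (auto simp: e_def)
  have e0: "e \<longlonglongrightarrow> 0" unfolding e_def by (rule LIMSEQ_inverse_real_of_nat)
  define J where "J n = (\<integral>t. ?F t * cis (2 * pi * (t \<bullet> x)) * of_real (gaussian (e n *\<^sub>R t)) \<partial>lborel)" for n
  have J_lim: "J \<longlonglongrightarrow> (\<integral>t. ?F t * cis (2 * pi * (t \<bullet> x)) \<partial>lborel)"
    unfolding J_def
  proof (rule integral_dominated_convergence[where w = "\<lambda>t. norm (?F t)"])
    show "integrable lborel (\<lambda>t. norm (?F t))" using intF by simp
    show "AE t in lborel. (\<lambda>n. ?F t * cis (2 * pi * (t \<bullet> x)) * of_real (gaussian (e n *\<^sub>R t)))
        \<longlonglongrightarrow> ?F t * cis (2 * pi * (t \<bullet> x))"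
    proof (intro always_eventually allI)
      fix t :: "real ^ 'd"
      have "(\<lambda>n. gaussian (e n *\<^sub>R t)) \<longlonglongrightarrow> exp (- pi * (norm (0 *\<^sub>R t))\<^sup>2)"
        unfolding gaussian_def by (intro tendsto_intros e0)
      then have "(\<lambda>n. ?F t * cis (2 * pi * (t \<bullet> x)) * of_real (gaussian (e n *\<^sub>R t)))
        \<longlonglongrightarrow> ?F t * cis (2 * pi * (t \<bullet> x)) * of_real (exp (- pi * (norm (0 *\<^sub>R t))\<^sup>2))"
        by (intro tendsto_intros)
      then show "(\<lambda>n. ?F t * cis (2 * pi * (t \<bullet> x)) * of_real (gaussian (e n *\<^sub>R t)))
        \<longlonglongrightarrow> ?F t * cis (2 * pi * (t \<bullet> x))" by simp
    qed
    show "AE t in lborel. norm (?F t * cis (2 * pi * (t \<bullet> x)) * of_real (gaussian (e n *\<^sub>R t))) \<le> norm (?F t)" for n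
      by (auto simp: norm_mult gaussian_def intro!: mult_left_le)
  qed auto
  have J_eq: "J n = (\<integral>z. f (x + (- e n) *\<^sub>R z) * of_real (gaussian z) \<partial>lborel)" for n
  proof -
    let ?g = "\<lambda>t y. f y * cis (2 * pi * (t \<bullet> (x - y))) * of_real (gaussian (e n *\<^sub>R t))"
    have e_int: "integrable lborel (\<lambda>t::real^'d. gaussian (e n *\<^sub>R t))"
      using lborel_integrable_affine_iff[OF gaussian_measurable, of "e n" "0 :: real ^ 'd"] int_gauss_real e[of n] by simp
    have int2: "integrable (lborel \<Otimes>\<^sub>M lborel) (case_prod ?g)"
    proof (rule lborel_pair.Fubini_integrable)
      show "integrable lborel (\<lambda>t. \<integral>y. norm (case (t, y) of (t, y) \<Rightarrow> ?g t y) \<partial>lborel)"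
        using e_int by (simp add: norm_mult gaussian_def)
      show "AE t in lborel. integrable lborel (\<lambda>y. case (t, y) of (t, y) \<Rightarrow> ?g t y)"
        using int by (auto intro!: AE_I2 integrable_mult_left integrable_mult_cis)
    qed measurable
    have "J n = (\<integral>t. (\<integral>y. ?g t y \<partial>lborel) \<partial>lborel)"
      unfolding J_def
    proof (intro Bochner_Integration.integral_cong refl)
      fix t
      have "?F t * cis (2 * pi * (t \<bullet> x)) = (\<integral>y. f y * cis (2 * pi * (t \<bullet> (x - y))) \<partial>lborel)"
        unfolding fourier_cis
        by (subst integral_mult_left_zero[symmetric]) (simp add: mult.assoc cis_mult inner_diff_right algebra_simps)
      then show "?F t * cis (2 * pi * (t \<bullet> x)) * of_real (gaussian (e n *\<^sub>R t)) = (\<integral>y. ?g t y \<partial>lborel)"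
        by simp
    qed
    also have "\<dots> = (\<integral>y. (\<integral>t. ?g t y \<partial>lborel) \<partial>lborel)"
      by (rule lborel_pair.Fubini_integral[OF int2, symmetric])
    \<comment> \<open>Substituting \<open>t = u / e n\<close> gives the Fourier transform of the Gaussian at \<open>(x - y) / e n\<close>.\<close>
    also have "\<dots> = (\<integral>y. f y * of_real (inverse (e n) ^ ?d * gaussian ((x - y) /\<^sub>R e n)) \<partial>lborel)"
    proof (intro Bochner_Integration.integral_cong refl)
      fix y
      have "(\<integral>t. ?g t y \<partial>lborel) = f y * (\<integral>t. cis (2 * pi * (t \<bullet> (x - y))) * of_real (gaussian (e n *\<^sub>R t)) \<partial>lborel)"
        by (simp add: mult.assoc)
      also have "(\<integral>t. cis (2 * pi * (t \<bullet> (x - y))) * of_real (gaussian (e n *\<^sub>R t)) \<partial>lborel)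
        = inverse (e n) ^ ?d *\<^sub>R (\<integral>u. of_real (gaussian u) * cis (2 * pi * (((x - y) /\<^sub>R e n) \<bullet> u)) \<partial>lborel)"
        using e[of n] by (subst lborel_integral_affine[of _ "inverse (e n)" 0]) (auto simp: inner_commute mult_ac)
      finally show "(\<integral>t. ?g t y \<partial>lborel) = f y * of_real (inverse (e n) ^ ?d * gaussian ((x - y) /\<^sub>R e n))"
        by (simp add: fourier_gaussian(2) scaleR_conv_of_real)
    qed
    \<comment> \<open>Substituting \<open>y = x - e n z\<close>; the two Jacobian factors cancel.\<close>
    also have "\<dots> = (\<integral>z. f (x + (- e n) *\<^sub>R z) * of_real (gaussian z) \<partial>lborel)"
    proof -
      let ?k = "\<lambda>y. f y * of_real (inverse (e n) ^ ?d * gaussian ((x - y) /\<^sub>R e n))"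
      have "?k (x + (- e n) *\<^sub>R z) = inverse (e n) ^ ?d *\<^sub>R (f (x + (- e n) *\<^sub>R z) * of_real (gaussian z))" for z
        using e[of n] by (simp add: scaleR_conv_of_real[where 'a = complex])
      then have "(\<integral>z. ?k (x + (- e n) *\<^sub>R z) \<partial>lborel)
          = inverse (e n) ^ ?d *\<^sub>R (\<integral>z. f (x + (- e n) *\<^sub>R z) * of_real (gaussian z) \<partial>lborel)"
        by (simp only: integral_scaleR_right)
      moreover have "?k \<in> borel_measurable borel" by measurable
      ultimately show ?thesis
        using lborel_integral_affine[of ?k "- e n" x] e[of n]
        by (simp add: power_mult_distrib[symmetric] del: of_real_mult of_real_power)
    qed
    finally show ?thesis .
  qed
  have approx: "(\<lambda>n. (\<integral>z. f (x + (- e n) *\<^sub>R z) * of_real (gaussian z) \<partial>lborel)) \<longlonglongrightarrow> (\<integral>z. f x * of_real (gaussian (z :: real ^ 'd)) \<partial>lborel)"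
  proof -
    obtain B where B: "\<And>y. norm (f y) \<le> B" using bdd by (auto simp: bounded_iff)
    show ?thesis
    proof (rule integral_dominated_convergence[where w = "\<lambda>z. B * gaussian z"])
      show "AE z in lborel. (\<lambda>n. f (x + (- e n) *\<^sub>R z) * of_real (gaussian z)) \<longlonglongrightarrow> f x * of_real (gaussian z)"
      proof (intro always_eventually allI)
        fix z :: "real ^ 'd"
        have "(\<lambda>n. x + (- e n) *\<^sub>R z) \<longlonglongrightarrow> x + (- 0) *\<^sub>R z" by (intro tendsto_intros e0)
        then have "(\<lambda>n. f (x + (- e n) *\<^sub>R z)) \<longlonglongrightarrow> f x"
          using isCont_tendsto_compose[OF cont] by simp
        then show "(\<lambda>n. f (x + (- e n) *\<^sub>R z) * of_real (gaussian z)) \<longlonglongrightarrow> f x * of_real (gaussian z)"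
          by (intro tendsto_intros)
      qed
      show "AE z in lborel. norm (f (x + (- e n) *\<^sub>R z) * of_real (gaussian z)) \<le> B * gaussian z" for n
        using B by (auto simp: norm_mult gaussian_def intro!: mult_right_mono)
    qed (use int_gauss_real in auto)
  qed
  have mass: "(\<integral>z. f x * of_real (gaussian (z :: real ^ 'd)) \<partial>lborel) = f x"
    using fourier_gaussian(2)[of "0 :: real ^ 'd"] by (simp add: gaussian_def)
  show ?thesis
    using LIMSEQ_unique[OF J_lim approx[folded J_eq]] mass by simp
qed

section \<open>Measures with a tight-frame spectrum\<close>

text \<open>The Fourier transform turns convolution into multiplication and reflection into complex
  conjugation. The value is real, so the sign of the exponent is immaterial; the positive
  sign is the one that Fourier inversion produces.\<close>

lemma fourier_autocorrelation:
  fixes \<mu> :: "(real ^ 'd) measure"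
  assumes "prob_space \<mu>" and sets [measurable_cong]: "sets \<mu> = sets borel"
  shows "(\<integral>x. cis (2 * pi * (s \<bullet> x)) \<partial>convolution \<mu> (reflected \<mu>)) = of_real ((cmod (fourier \<mu> (\<lambda>_. 1) s))\<^sup>2)"
proof -
  interpret \<mu>: prob_space \<mu> by fact
  have sets_r [measurable_cong]: "sets (reflected \<mu>) = sets borel" by (simp add: reflected_def)
  have um [measurable]: "uminus \<in> measurable \<mu> borel" by measurable
  interpret r: prob_space "reflected \<mu>"
    unfolding reflected_def by (rule \<mu>.prob_space_distr) (rule um)
  interpret pair_sigma_finite \<mu> "reflected \<mu>" ..
  interpret pair_prob_space \<mu> "reflected \<mu>" ..
  let ?e = "\<lambda>x. cis (2 * pi * (s \<bullet> x))"
  have int: "integrable (\<mu> \<Otimes>\<^sub>M reflected \<mu>) (\<lambda>(x, y). ?e (x + y))"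
    by (rule P.integrable_const_bound[where B = 1]) auto
  have "(\<integral>x. ?e x \<partial>convolution \<mu> (reflected \<mu>)) = (\<integral>(x, y). ?e (x + y) \<partial>(\<mu> \<Otimes>\<^sub>M reflected \<mu>))"
    unfolding convolution_def by (subst integral_distr) (auto simp: case_prod_unfold)
  also have "\<dots> = (\<integral>x. (\<integral>y. ?e (x + y) \<partial>reflected \<mu>) \<partial>\<mu>)"
    using integral_fst'[OF int] by simp
  also have "\<dots> = (\<integral>x. ?e x \<partial>\<mu>) * (\<integral>y. ?e y \<partial>reflected \<mu>)"
  proof -
    have "?e (x + y) = ?e x * ?e y" for x y by (simp add: cis_mult inner_add_right distrib_left)
    then show ?thesis by (simp only: integral_mult_left_zero integral_mult_right_zero)
  qed
  also have "(\<integral>y. ?e y \<partial>reflected \<mu>) = fourier \<mu> (\<lambda>_. 1) s"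
    unfolding reflected_def fourier_cis by (subst integral_distr) auto
  also have "(\<integral>x. ?e x \<partial>\<mu>) = cnj (fourier \<mu> (\<lambda>_. 1) s)"
    unfolding fourier_cis by (subst Bochner_Integration.integral_cnj[symmetric]) (simp add: cis_cnj)
  finally show ?thesis
    by (metis complex_norm_square mult.commute)
qed

text \<open>The frame identity for the character with frequency \<open>t\<close>, which has \<open>L\<^sup>2\<close> norm \<open>1\<close>.\<close>

lemma tight_frame_translates:
  fixes \<mu> :: "(real ^ 'd) measure"
  assumes "prob_space \<mu>" and sets [measurable_cong]: "sets \<mu> = sets borel"
    and "tight_frame_spectrum \<mu> \<Lambda>"
  obtains A where "\<And>t. ((\<lambda>l. (cmod (fourier \<mu> (\<lambda>_. 1) (l - t)))\<^sup>2) has_sum A) \<Lambda>"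
proof -
  interpret \<mu>: prob_space \<mu> by fact
  obtain A where A: "((\<lambda>l. (cmod (fourier \<mu> f l))\<^sup>2) has_sum (A * (\<integral>x. (cmod (f x))\<^sup>2 \<partial>\<mu>))) \<Lambda>"
    if "square_integrable \<mu> f" for f
    using assms(3) by (auto simp: tight_frame_spectrum_def)
  have "((\<lambda>l. (cmod (fourier \<mu> (\<lambda>_. 1) (l - t)))\<^sup>2) has_sum A) \<Lambda>" for t
  proof -
    have "fourier \<mu> (\<lambda>x. cis (2 * pi * (t \<bullet> x))) l = fourier \<mu> (\<lambda>_. 1) (l - t)" for l
      unfolding fourier_cis by (simp add: cis_mult inner_diff_left algebra_simps)
    then show ?thesis
      using A[of "\<lambda>x. cis (2 * pi * (t \<bullet> x))"]
      by (simp add: square_integrable_def \<mu>.prob_space)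
  qed
  then show ?thesis by (rule that)
qed

text \<open>A measure that has a density only inside \<open>U\<close> still integrates functions that vanish outside
  \<open>U\<close> through that density: restrict \<open>\<nu>\<close> to \<open>U\<close>, which makes it a measure with density on the whole space.\<close>

lemma integral_density_on:
  fixes h :: "'a::euclidean_space \<Rightarrow> complex"
  assumes sets: "sets \<nu> = sets borel" and "open U" and cont: "continuous_on U g"
    and nonneg: "\<And>x. x \<in> U \<Longrightarrow> 0 \<le> g x"
    and dens: "\<And>E. E \<in> sets borel \<Longrightarrow> E \<subseteq> U \<Longrightarrow> emeasure \<nu> E = (\<integral>\<^sup>+x\<in>E. ennreal (g x) \<partial>lborel)"
    and h [measurable]: "h \<in> borel_measurable borel" and supp: "\<And>x. x \<notin> U \<Longrightarrow> h x = 0"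
  shows "(\<integral>x. h x \<partial>\<nu>) = (\<integral>x. of_real (g x) * h x \<partial>lborel)"
proof -
  have U [measurable]: "U \<in> sets borel" using \<open>open U\<close> by simp
  let ?g = "\<lambda>x. indicator U x * g x"
  have g [measurable]: "?g \<in> borel_measurable borel"
    using borel_measurable_continuous_on_indicator[OF U cont] by simp
  have eq: "density \<nu> (indicator U) = density lborel (\<lambda>x. ennreal (?g x))"
  proof (rule measure_eqI)
    fix E assume "E \<in> sets (density \<nu> (indicator U))"
    then have E [measurable]: "E \<in> sets borel" by (simp add: sets)
    have "emeasure (density \<nu> (indicator U)) E = emeasure \<nu> (U \<inter> E)"
      using sets by (subst emeasure_density)
        (auto simp: sets nn_integral_indicator[symmetric] indicator_inter_arith
          simp del: nn_integral_indicator cong: measurable_cong_sets)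
    also have "\<dots> = (\<integral>\<^sup>+x\<in>U \<inter> E. ennreal (g x) \<partial>lborel)"
      by (rule dens) auto
    also have "\<dots> = emeasure (density lborel (\<lambda>x. ennreal (?g x))) E"
      using g by (subst emeasure_density) (measurable, auto intro!: nn_integral_cong simp: indicator_def)
    finally show "emeasure (density \<nu> (indicator U)) E = emeasure (density lborel (\<lambda>x. ennreal (?g x))) E" .
  qed (simp add: sets)
  have hU: "indicator U x *\<^sub>R h x = h x" for x using supp by (auto simp: indicator_def)
  have h\<nu>: "h \<in> borel_measurable \<nu>" "(indicator U :: _ \<Rightarrow> real) \<in> borel_measurable \<nu>"
    using sets by (auto cong: measurable_cong_sets)
  have "(\<integral>x. h x \<partial>\<nu>) = (\<integral>x. h x \<partial>density \<nu> (\<lambda>x. ennreal (indicator U x)))"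
    using h\<nu> by (subst integral_density) (auto simp: hU)
  also have "\<dots> = (\<integral>x. h x \<partial>density lborel (\<lambda>x. ennreal (?g x)))"
    using eq by (simp add: ennreal_indicator)
  also have "\<dots> = (\<integral>x. ?g x *\<^sub>R h x \<partial>lborel)"
    using g nonneg by (subst integral_density) (measurable, auto simp: indicator_def)
  also have "\<dots> = (\<integral>x. of_real (g x) * h x \<partial>lborel)"
    using supp by (intro Bochner_Integration.integral_cong) (auto simp: indicator_def scaleR_conv_of_real)
  finally show ?thesis .
qed

text \<open>Fubini for Lebesgue measure and the counting measure on \<open>\<Lambda>\<close>. Since the weights are
  nonnegative, the absolute values integrate to \<open>A \<integral> |F|\<close>.\<close>

lemma infsum_integral_swap:
  fixes F :: "'a::euclidean_space \<Rightarrow> complex" and w :: "'b \<Rightarrow> 'a \<Rightarrow> real"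
  assumes "countable \<Lambda>" and F: "integrable lborel F" and w [measurable]: "\<And>l. w l \<in> borel_measurable borel"
    and nonneg: "\<And>l t. 0 \<le> w l t" and sum: "\<And>t. ((\<lambda>l. w l t) has_sum A) \<Lambda>"
  shows "(\<Sum>\<^sub>\<infinity>l\<in>\<Lambda>. \<integral>t. F t * of_real (w l t) \<partial>lborel) = A * (\<integral>t. F t \<partial>lborel)"
proof -
  have [measurable]: "F \<in> borel_measurable borel" using F by (auto dest: borel_measurable_integrable)
  interpret S: sigma_finite_measure "count_space \<Lambda>"
    using \<open>countable \<Lambda>\<close> by (rule sigma_finite_measure_count_space_countable)
  interpret pair_sigma_finite lborel "count_space \<Lambda>" ..
  have abs: "Infinite_Set_Sum.abs_summable_on (\<lambda>l. w l t) \<Lambda>" for t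
    using sum[of t] nonneg by (subst abs_summable_equivalent[symmetric]) (auto intro: has_sum_imp_summable)
  have wsum: "(\<integral>l. w l t \<partial>count_space \<Lambda>) = A" for t
    using infsetsum_infsum[OF abs[of t]] infsumI[OF sum[of t]] by (simp add: infsetsum_def)
  have meas: "(\<lambda>(t, l). F t * of_real (w l t)) \<in> borel_measurable (lborel \<Otimes>\<^sub>M count_space \<Lambda>)"
    by (subst measurable_pair_swap_iff, rule measurable_pair_measure_countable1[OF \<open>countable \<Lambda>\<close>]) simp
  have int: "integrable (lborel \<Otimes>\<^sub>M count_space \<Lambda>) (\<lambda>(t, l). F t * of_real (w l t))"
  proof (rule Fubini_integrable[OF meas])
    show "integrable lborel (\<lambda>t. \<integral>l. norm (case (t, l) of (t, l) \<Rightarrow> F t * of_real (w l t)) \<partial>count_space \<Lambda>)"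
      using F nonneg by (simp add: norm_mult wsum)
    show "AE t in lborel. integrable (count_space \<Lambda>) (\<lambda>l. case (t, l) of (t, l) \<Rightarrow> F t * of_real (w l t))"
      using abs by (auto simp: Infinite_Set_Sum.abs_summable_on_def)
  qed
  have "Infinite_Set_Sum.abs_summable_on (\<lambda>l. \<integral>t. F t * of_real (w l t) \<partial>lborel) \<Lambda>"
    using integrable_snd[OF int] by (simp add: Infinite_Set_Sum.abs_summable_on_def)
  then have "(\<Sum>\<^sub>\<infinity>l\<in>\<Lambda>. \<integral>t. F t * of_real (w l t) \<partial>lborel)
      = (\<integral>l. (\<integral>t. F t * of_real (w l t) \<partial>lborel) \<partial>count_space \<Lambda>)"
    by (simp add: infsetsum_infsum[symmetric] infsetsum_def)
  also have "\<dots> = (\<integral>t. (\<integral>l. F t * of_real (w l t) \<partial>count_space \<Lambda>) \<partial>lborel)"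
    by (rule Fubini_integral[OF int])
  also have "\<dots> = A * (\<integral>t. F t \<partial>lborel)"
    by (simp add: wsum mult.commute)
  finally show ?thesis .
qed

text \<open>A Poisson-type formula: on \<open>U\<close> the Fourier transform of \<open>\<delta>_\<Lambda>\<close> acts as
  \<open>A / g(0)\<close> times the point mass at \<open>0\<close>. If \<open>0\<close> is not in \<open>U\<close> then \<open>\<phi> 0 = 0\<close> and the sum vanishes.\<close>

lemma summation_formula:
  fixes \<mu> :: "(real ^ 'd) measure" and g :: "real ^ 'd \<Rightarrow> real" and \<phi> :: "real ^ 'd \<Rightarrow> complex"
  assumes \<mu>: "prob_space \<mu>" and sets: "sets \<mu> = sets borel"
    and "countable \<Lambda>" and A: "\<And>t. ((\<lambda>l. (cmod (fourier \<mu> (\<lambda>_. 1) (l - t)))\<^sup>2) has_sum A) \<Lambda>"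
    and "open U" and g: "smooth_on U g" and pos: "\<And>x. x \<in> U \<Longrightarrow> 0 < g x"
    and dens: "\<And>E. E \<in> sets borel \<Longrightarrow> E \<subseteq> U \<Longrightarrow>
      emeasure (convolution \<mu> (reflected \<mu>)) E = (\<integral>\<^sup>+x\<in>E. ennreal (g x) \<partial>lborel)"
    and \<phi>: "smooth_on UNIV \<phi>" and K: "compact K" "K \<subseteq> U" and supp: "\<And>x. x \<notin> K \<Longrightarrow> \<phi> x = 0"
  shows "(\<Sum>\<^sub>\<infinity>l\<in>\<Lambda>. fourier lborel \<phi> l) = of_real A * (\<phi> 0 / of_real (g 0))"
proof -
  interpret \<mu>: prob_space \<mu> by fact
  let ?\<nu> = "convolution \<mu> (reflected \<mu>)"
  interpret \<nu>: finite_measure ?\<nu>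
    using sets by (intro convolution_finite)
      (auto simp: reflected_def intro!: \<mu>.finite_measure_distr \<mu>.finite_measure_axioms cong: measurable_cong_sets)
  have [measurable_cong]: "sets ?\<nu> = sets borel" by simp
  define \<psi> where "\<psi> x = \<phi> x / of_real (g x)" for x
  have \<psi>0: "\<psi> x = 0" if "x \<notin> K" for x using supp that by (simp add: \<psi>_def)
  \<comment> \<open>Outside \<open>K\<close> the quotient is \<open>0\<close> whatever the value of \<open>g\<close> (including \<open>g x = 0\<close>, as division
    by zero gives zero), so the two open sets \<open>U\<close> and \<open>- K\<close> cover the space.\<close>
  have "smooth_on U \<psi>"
    unfolding \<psi>_def using \<open>open U\<close> g pos \<phi> by (intro smooth_on_divide) (force simp: smooth_on_def)+
  moreover have "smooth_on (- K) \<psi>"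
    using K \<psi>0 by (intro smooth_on_zero) (auto simp: compact_imp_closed)
  ultimately have "smooth_on (U \<union> - K) \<psi>" by (rule smooth_on_Un)
  moreover have "U \<union> - K = UNIV" using K by auto
  ultimately have \<psi>: "smooth_on UNIV \<psi>" by simp
  have \<psi>cont: "continuous_on UNIV \<psi>" using continuous_on_partials[OF \<psi>, of "[]"] by simp
  have [measurable]: "\<psi> \<in> borel_measurable borel" using \<psi>cont by (rule borel_measurable_continuous_onI)
  have \<psi>int: "integrable lborel \<psi>" using integrable_compact_support K(1) \<psi>cont \<psi>0 .
  let ?F = "fourier lborel \<psi>"
  have F: "integrable lborel ?F" using integrable_fourier_smooth_compact[OF \<psi> K(1) \<psi>0] .
  then have [measurable]: "?F \<in> borel_measurable borel" by (auto dest: borel_measurable_integrable)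
  have inv: "(\<integral>t. ?F t * cis (2 * pi * (t \<bullet> x)) \<partial>lborel) = \<psi> x" for x
    using \<psi>int _ _ F
  proof (rule fourier_inversion)
    show "isCont \<psi> x" using \<psi>cont by (simp add: continuous_on_eq_continuous_at)
    show "bounded (range \<psi>)" using bounded_compact_support[OF K(1) \<psi>cont \<psi>0] .
  qed
  define w where "w l t = (cmod (fourier \<mu> (\<lambda>_. 1) (l - t)))\<^sup>2" for l t
  have w_nonneg: "0 \<le> w l t" for l t by (simp add: w_def)
  \<comment> \<open>\<open>|\<mu>^|\<close> is even since \<open>\<mu>\<close> is real: the frame identity uses \<open>l - t\<close>, inversion \<open>t - l\<close>.\<close>
  have w_symm: "w l t = (cmod (fourier \<mu> (\<lambda>_. 1) (t - l)))\<^sup>2" for l t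
  proof -
    have "fourier \<mu> (\<lambda>_. 1) (l - t) = cnj (fourier \<mu> (\<lambda>_. 1) (t - l))"
      unfolding fourier_cis by (subst Bochner_Integration.integral_cnj[symmetric])
        (simp add: cis_cnj inner_diff_left algebra_simps)
    then show ?thesis by (simp add: w_def)
  qed
  have coefficient: "fourier lborel \<phi> l = (\<integral>t. ?F t * of_real (w l t) \<partial>lborel)" for l
  proof -
    let ?e = "\<lambda>x. cis (- (2 * pi * (l \<bullet> x)))"
    let ?G = "\<lambda>t x. ?F t * cis (2 * pi * ((t - l) \<bullet> x))"
    interpret pair_sigma_finite lborel ?\<nu> ..
    have int: "integrable (lborel \<Otimes>\<^sub>M ?\<nu>) (case_prod ?G)"
    proof (rule Fubini_integrable)
      show "integrable lborel (\<lambda>t. \<integral>x. norm (case (t, x) of (t, x) \<Rightarrow> ?G t x) \<partial>?\<nu>)"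
        using F by (simp add: norm_mult)
      show "AE t in lborel. integrable ?\<nu> (\<lambda>x. case (t, x) of (t, x) \<Rightarrow> ?G t x)"
      proof (rule AE_I2)
        fix t
        have "integrable ?\<nu> (\<lambda>x. cis (2 * pi * ((t - l) \<bullet> x)))"
          by (rule \<nu>.integrable_const_bound[where B = 1]) auto
        then show "integrable ?\<nu> (\<lambda>x. case (t, x) of (t, x) \<Rightarrow> ?G t x)" by simp
      qed
      show "case_prod ?G \<in> borel_measurable (lborel \<Otimes>\<^sub>M ?\<nu>)"
        by measurable
    qed
    have "fourier lborel \<phi> l = (\<integral>x. of_real (g x) * (\<psi> x * ?e x) \<partial>lborel)"
      unfolding fourier_cis
    proof (intro Bochner_Integration.integral_cong refl)
      fix x
      show "\<phi> x * ?e x = of_real (g x) * (\<psi> x * ?e x)"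
        using pos[of x] K(2) supp[of x] by (cases "x \<in> K") (auto simp: \<psi>_def)
    qed
    also have "\<dots> = (\<integral>x. \<psi> x * ?e x \<partial>?\<nu>)"
    proof (rule integral_density_on[symmetric, where U = U])
      show "continuous_on U g"
        using continuous_on_partials[OF g, of "[]"] by simp
      show "\<psi> x * ?e x = 0" if "x \<notin> U" for x using that K(2) \<psi>0 by auto
    qed (use pos dens \<open>open U\<close> in \<open>auto intro: less_imp_le\<close>)
    also have "\<dots> = (\<integral>x. (\<integral>t. ?G t x \<partial>lborel) \<partial>?\<nu>)"
    proof (intro Bochner_Integration.integral_cong refl)
      fix x
      have "?G t x = ?F t * cis (2 * pi * (t \<bullet> x)) * ?e x" for t
        by (simp add: mult.assoc cis_mult inner_diff_left algebra_simps)
      then have "(\<integral>t. ?G t x \<partial>lborel) = (\<integral>t. ?F t * cis (2 * pi * (t \<bullet> x)) \<partial>lborel) * ?e x"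
        by (simp only: integral_mult_left_zero)
      then show "\<psi> x * ?e x = (\<integral>t. ?G t x \<partial>lborel)" by (simp only: inv)
    qed
    also have "\<dots> = (\<integral>t. (\<integral>x. ?G t x \<partial>?\<nu>) \<partial>lborel)"
      by (rule Fubini_integral[OF int])
    also have "\<dots> = (\<integral>t. ?F t * of_real (w l t) \<partial>lborel)"
      using fourier_autocorrelation[OF \<mu> sets] by (simp add: w_symm)
    finally show ?thesis .
  qed
  have [measurable_cong]: "sets \<mu> = sets borel" by (fact sets)
  have "w l \<in> borel_measurable borel" for l
    unfolding w_def fourier_cis by measurable
  then have "(\<Sum>\<^sub>\<infinity>l\<in>\<Lambda>. fourier lborel \<phi> l) = A * (\<integral>t. ?F t \<partial>lborel)"
    unfolding coefficient using \<open>countable \<Lambda>\<close> F w_nonneg A[folded w_def]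
    by (intro infsum_integral_swap) auto
  then show ?thesis
    using inv[of 0] by (simp add: \<psi>_def)
qed

theorem theorem3:
  fixes \<mu> :: "(real ^ 'd) measure" and \<Lambda> U :: "(real ^ 'd) set"
  assumes "compact_borel_prob \<mu>"
    and "tight_frame_spectrum \<mu> \<Lambda>"
    and "open U"
    and "smooth_positive_density_on (convolution \<mu> (reflected \<mu>)) U"
  shows "dist_support (fourier_dist (delta_dist \<Lambda>)) \<inter> U \<subseteq> {0}"
proof
  fix x assume x: "x \<in> dist_support (fourier_dist (delta_dist \<Lambda>)) \<inter> U"
  obtain g where g: "smooth_on U g" "\<And>x. x \<in> U \<Longrightarrow> 0 < g x"
    "\<And>E. E \<in> sets borel \<Longrightarrow> E \<subseteq> U \<Longrightarrow>
      emeasure (convolution \<mu> (reflected \<mu>)) E = (\<integral>\<^sup>+x\<in>E. ennreal (g x) \<partial>lborel)"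
    using assms(4) unfolding smooth_positive_density_on_def by blast
  have \<mu>: "prob_space \<mu>" "sets \<mu> = sets borel"
    using assms(1) by (auto simp: compact_borel_prob_def)
  have "countable \<Lambda>" using assms(2) by (simp add: tight_frame_spectrum_def)
  obtain A where A: "((\<lambda>l. (cmod (fourier \<mu> (\<lambda>_. 1) (l - t)))\<^sup>2) has_sum A) \<Lambda>" for t
    using tight_frame_translates[OF \<mu> assms(2)] by blast
  show "x \<in> {0}"
  proof (rule ccontr)
    assume "x \<notin> {0}"
    then have "open (U - {0})" "x \<in> U - {0}" using x \<open>open U\<close> by auto
    then obtain r where r: "0 < r" "ball x r \<subseteq> U - {0}" unfolding open_contains_ball by blast
    have "vanishes_on (fourier_dist (delta_dist \<Lambda>)) (ball x r)"
      unfolding vanishes_on_def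
    proof (intro allI impI, elim conjE)
      fix \<phi> :: "real ^ 'd \<Rightarrow> complex"
      let ?K = "closure {x. \<phi> x \<noteq> 0}"
      assume \<phi>: "schwartz \<phi>" and K: "?K \<subseteq> ball x r"
      have supp: "\<phi> y = 0" if "y \<notin> ?K" for y
        using that closure_subset[of "{x. \<phi> x \<noteq> 0}"] by auto
      have K': "compact ?K" "?K \<subseteq> U"
        using K r(2) bounded_subset[OF bounded_ball K] by (auto simp: compact_eq_bounded_closed)
      have "smooth_on UNIV \<phi>" using \<phi> by (simp add: schwartz_def)
      have "(\<Sum>\<^sub>\<infinity>l\<in>\<Lambda>. fourier lborel \<phi> l) = of_real A * (\<phi> 0 / of_real (g 0))"
        by (rule summation_formula[OF \<mu> \<open>countable \<Lambda>\<close> A \<open>open U\<close> g \<open>smooth_on UNIV \<phi>\<close> K' supp])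
      moreover have "\<phi> 0 = 0" by (rule supp) (use K r(2) in auto)
      ultimately show "fourier_dist (delta_dist \<Lambda>) \<phi> = 0"
        by (simp add: fourier_dist_def delta_dist_def)
    qed
    then have "x \<notin> dist_support (fourier_dist (delta_dist \<Lambda>))"
      using r(1) by (auto simp: dist_support_def intro!: exI[of _ "ball x r"])
    then show False using x by blast
  qed
qed

end
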